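(* Let $I\subset\mathbb{R}$ be an open interval. Consider the following two systems. (A) For $\mathbf{X}=(x_1,\dots,x_{N_p})^\top:I\to\mathbb{R}^{N_p}$ and $\boldsymbol\phi=(\phi_1,\dots,\phi_N)^\top:I\to\mathbb{R}^N$: $$\ddot{x}_k = Z\sum_{j=1}^N \Delta x\, S'(\xi_j-x_k)\,\phi_j,\qquad k=1,\dots,N_p,\tag{A1}$$ $$-Z\sum_{k=1}^{N_p} w_k S(\xi_j-x_k) + (\mathbb{A}\boldsymbol\phi)_j + n_0(\xi_j)\exp\left(\frac{\phi_j-\phi_0(\xi_j)}{T_e(\xi_j)}\right)=0,\qquad j=1,\dots,N.\tag{A2}$$ (B) For $\mathbf{X},\mathbf{V}:I\to\mathbb{R}^{N_p}$, with $\mathbf{V}=(v_1,\dots,v_{N_p})^\top$: $$\dot{x}_k=\frac{1}{w_k}\,\partial_{v_k}H(\mathbf{X},\mathbf{V}),\qquad \dot{v}_k=-\frac{1}{w_k}\,\partial_{x_k}H(\mathbf{X},\mathbf{V}),\qquad k=1,\dots,N_p,$$ where $$H(\mathbf{X},\mathbf{V})=-\frac12\,\boldsymbol\phi^\top\mathbb{A}\boldsymbol\phi\,\Delta x+Z\sum_{j=1}^N\Delta x\sum_{k=1}^{N_p}w_kS(\xi_j-x_k)\phi_j+\frac12\sum_{k=1}^{N_p}w_kv_k^2-\sum_{j=1}^N\Delta x\,T_e(\xi_j)\,n_0(\xi_j)\exp\left(\frac{\phi_j-\phi_0(\xi_j)}{T_e(\xi_j)}\right)$$ and $\boldsymbol\phi=\boldsymbol\phi(\mathbf{X})$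 is determined by $\mathbf{X}$ through (A2). Then both discretizations conserve discrete neutrality: for every solution $(\mathbf{X},\boldsymbol\phi)$ of (A), and for every solution $(\mathbf{X},\mathbf{V})$ of (B) with $\boldsymbol\phi=\boldsymbol\phi(\mathbf{X})$, at every time $t\in I$, $$Z\sum_{j=1}^N\sum_{k=1}^{N_p}w_kS(\xi_j-x_k(t))\,\Delta x=\sum_{j=1}^N n_0(\xi_j)\exp\left(\frac{\phi_j(t)-\phi_0(\xi_j)}{T_e(\xi_j)}\right)\Delta x .$$
   Context: Setting: a particle-in-cell / finite-difference discretization, in one space dimension with periodic boundary conditions, of the hybrid plasma model $\partial_t f+v\,\partial_xf-Z\,\partial_x\phi\,\partial_vf=0$, $-\partial_x^2\phi=Z\int f\,dv-n_0\exp((\phi-\phi_0)/T_e)$. Discrete neutrality is the discrete analogue of $Z\int f\,dx\,dv=\int n_0\exp((\phi-\phi_0)/T_e)\,dx$. Notation: $N\ge 3$ is the number of grid points, $N_p\geq 1$ the number of particles, $L>0$ the period, $\Delta x=L/N$, and $\xi_1,\dots,\xi_N$ (with $\xi_{j+1}=\xi_j+\Delta x$) is a uniform grid on the periodic domain. $Z>0$ is a constant (ion charge number), $w_k>0$ ($k=1,\dots,N_p$) are constant particle weights, $x_k,v_k\in\mathbb{R}$ are the particle positions and velocities. $S:\mathbb{R}\to\mathbb{R}$ is the particle shape function (typically a B-spline), taken to be $L$-periodic (periodized) and continuously differentiable, with derivative $S'$. $n_0,\phi_0,T_e$ are given time-independent real functions on the grid, with $n_0(\xi_j)>0$ and $T_e(\xi_j)>0$.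 $\mathbb{A}$ is the $N\times N$ symmetric periodic finite-difference matrix of $-\partial_x^2$: $(\mathbb{A}\boldsymbol\phi)_j=\dfrac{2\phi_j-\phi_{j+1}-\phi_{j-1}}{\Delta x^2}$, with indices modulo $N$. Standing assumption: the potential is determined by the particles, i.e. for each $\mathbf{X}\in\mathbb{R}^{N_p}$ the equation (A2) has a unique solution $\boldsymbol\phi(\mathbf{X})\in\mathbb{R}^N$, and it depends differentiably on $\mathbf{X}$. *)

theory Defs
  imports "HOL-Analysis.Analysis"
begin

text \<open>
  Particle quantities are vectors indexed by a finite type \<open>'p\<close> (so the number of particles is
  \<open>CARD('p)\<close>).  Grid quantities need cyclic neighbours, so they are functions of
  an index in \<open>{1..N}\<close>; their values outside \<open>{1..N}\<close> are irrelevant.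
\<close>

definition cyc_next :: "nat \<Rightarrow> nat \<Rightarrow> nat" where
  "cyc_next N j = (if j = N then 1 else j + 1)"

definition cyc_prev :: "nat \<Rightarrow> nat \<Rightarrow> nat" where
  "cyc_prev N j = (if j = 1 then N else j - 1)"

text \<open>
  The periodic finite-difference matrix \<open>A\<close> of the negative second derivative, given by its
  action: \<open>fd_lap N dx \<phi> j\<close> is \<open>(A \<phi>)\<^sub>j\<close>.
\<close>

definition fd_lap :: "nat \<Rightarrow> real \<Rightarrow> (nat \<Rightarrow> real) \<Rightarrow> nat \<Rightarrow> real" where
  "fd_lap N dx \<phi> j = (2 * \<phi> j - \<phi> (cyc_next N j) - \<phi> (cyc_prev N j)) / dx\<^sup>2"

definition poisson_boltzmann ::
  "nat \<Rightarrow> real \<Rightarrow> (nat \<Rightarrow> real) \<Rightarrow> real \<Rightarrow> real ^ 'p \<Rightarrow> (real \<Rightarrow> real) \<Rightarrow>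
   (real \<Rightarrow> real) \<Rightarrow> (real \<Rightarrow> real) \<Rightarrow> (real \<Rightarrow> real) \<Rightarrow> real ^ 'p \<Rightarrow> (nat \<Rightarrow> real) \<Rightarrow> bool" where
  "poisson_boltzmann N dx \<xi> Z w S n\<^sub>0 \<phi>\<^sub>0 T\<^sub>e X \<phi> \<longleftrightarrow>
     (\<forall>j\<in>{1..N}.
        - Z * (\<Sum>k\<in>UNIV. w $ k * S (\<xi> j - X $ k)) + fd_lap N dx \<phi> j
        + n\<^sub>0 (\<xi> j) * exp ((\<phi> j - \<phi>\<^sub>0 (\<xi> j)) / T\<^sub>e (\<xi> j)) = 0)"

text \<open>
  \<open>V\<close> is the first derivative of \<open>X\<close>.  Derivatives are two-sided, as \<open>I\<close> is meant to be open.
\<close>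

definition solves_A ::
  "nat \<Rightarrow> real \<Rightarrow> (nat \<Rightarrow> real) \<Rightarrow> real \<Rightarrow> real ^ 'p \<Rightarrow> (real \<Rightarrow> real) \<Rightarrow> (real \<Rightarrow> real) \<Rightarrow>
   (real \<Rightarrow> real) \<Rightarrow> (real \<Rightarrow> real) \<Rightarrow> (real \<Rightarrow> real) \<Rightarrow>
   real set \<Rightarrow> (real \<Rightarrow> real ^ 'p) \<Rightarrow> (real \<Rightarrow> nat \<Rightarrow> real) \<Rightarrow> bool" where
  "solves_A N dx \<xi> Z w S S' n\<^sub>0 \<phi>\<^sub>0 T\<^sub>e I X \<phi> \<longleftrightarrow>
     (\<exists>V :: real \<Rightarrow> real ^ 'p. \<forall>t\<in>I. \<forall>k.
        ((\<lambda>s. X s $ k) has_real_derivative V t $ k) (at t) \<and>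
        ((\<lambda>s. V s $ k) has_real_derivative
           Z * (\<Sum>j=1..N. dx * S' (\<xi> j - X t $ k) * \<phi> t j)) (at t)) \<and>
     (\<forall>t\<in>I. poisson_boltzmann N dx \<xi> Z w S n\<^sub>0 \<phi>\<^sub>0 T\<^sub>e (X t) (\<phi> t))"

text \<open>The Hamiltonian; \<open>\<Phi>\<close> is the map taking \<open>X\<close> to the potential \<open>\<phi>(X)\<close>.\<close>

definition hamiltonian ::
  "nat \<Rightarrow> real \<Rightarrow> (nat \<Rightarrow> real) \<Rightarrow> real \<Rightarrow> real ^ 'p \<Rightarrow> (real \<Rightarrow> real) \<Rightarrow>
   (real \<Rightarrow> real) \<Rightarrow> (real \<Rightarrow> real) \<Rightarrow> (real \<Rightarrow> real) \<Rightarrow>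
   (real ^ 'p \<Rightarrow> nat \<Rightarrow> real) \<Rightarrow> real ^ 'p \<Rightarrow> real ^ 'p \<Rightarrow> real" where
  "hamiltonian N dx \<xi> Z w S n\<^sub>0 \<phi>\<^sub>0 T\<^sub>e \<Phi> X V =
     - (1 / 2) * (\<Sum>j=1..N. \<Phi> X j * fd_lap N dx (\<Phi> X) j) * dx
     + Z * (\<Sum>j=1..N. dx * (\<Sum>k\<in>UNIV. w $ k * S (\<xi> j - X $ k) * \<Phi> X j))
     + (1 / 2) * (\<Sum>k\<in>UNIV. w $ k * (V $ k)\<^sup>2)
     - (\<Sum>j=1..N. dx * T\<^sub>e (\<xi> j) * n\<^sub>0 (\<xi> j)
                      * exp ((\<Phi> X j - \<phi>\<^sub>0 (\<xi> j)) / T\<^sub>e (\<xi> j)))"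

definition partial_deriv :: "'p \<Rightarrow> (real ^ 'p \<Rightarrow> real) \<Rightarrow> real ^ 'p \<Rightarrow> real" where
  "partial_deriv k F X = deriv (\<lambda>s. F (\<chi> i. if i = k then s else X $ i)) (X $ k)"

definition solves_B ::
  "real ^ 'p \<Rightarrow> (real ^ 'p \<Rightarrow> real ^ 'p \<Rightarrow> real) \<Rightarrow>
   real set \<Rightarrow> (real \<Rightarrow> real ^ 'p) \<Rightarrow> (real \<Rightarrow> real ^ 'p) \<Rightarrow> bool" where
  "solves_B w H I X V \<longleftrightarrow>
     (\<forall>t\<in>I. \<forall>k.
        ((\<lambda>s. X s $ k) has_real_derivative
           1 / w $ k * partial_deriv k (\<lambda>v. H (X t) v) (V t)) (at t) \<and>
        ((\<lambda>s. V s $ k) has_real_derivative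
           - (1 / w $ k) * partial_deriv k (\<lambda>x. H x (V t)) (X t)) (at t))"

definition discrete_neutrality ::
  "nat \<Rightarrow> real \<Rightarrow> (nat \<Rightarrow> real) \<Rightarrow> real \<Rightarrow> real ^ 'p \<Rightarrow> (real \<Rightarrow> real) \<Rightarrow>
   (real \<Rightarrow> real) \<Rightarrow> (real \<Rightarrow> real) \<Rightarrow> (real \<Rightarrow> real) \<Rightarrow> real ^ 'p \<Rightarrow> (nat \<Rightarrow> real) \<Rightarrow> bool" where
  "discrete_neutrality N dx \<xi> Z w S n\<^sub>0 \<phi>\<^sub>0 T\<^sub>e X \<phi> \<longleftrightarrow>
     Z * (\<Sum>j=1..N. \<Sum>k\<in>UNIV. w $ k * S (\<xi> j - X $ k) * dx) =
     (\<Sum>j=1..N. n\<^sub>0 (\<xi> j) * exp ((\<phi> j - \<phi>\<^sub>0 (\<xi> j)) / T\<^sub>e (\<xi> j)) * dx)"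

end

theory Submission
  imports Defs
begin

text \<open>
  Discrete neutrality holds at each instant because the potential at that instant solves the
  discrete Poisson-Boltzmann equation: (A) contains the equation, and in (B) the potential is
  by definition its solution.  Summing the equation over one period of the grid removes the
  Laplacian term, since each column of the periodic difference matrix sums to zero
  (\<open>sum_fd_lap_eq_0\<close>), and what is left, multiplied by the grid spacing, is the neutrality
  identity (\<open>poisson_boltzmann_imp_discrete_neutrality\<close>).
\<close>

lemma bij_betw_cyc_next: "bij_betw (cyc_next N) {1..N} {1..N}"
  by (rule bij_betw_byWitness[where f' = "cyc_prev N"])
     (auto simp: cyc_next_def cyc_prev_def)

lemma bij_betw_cyc_prev: "bij_betw (cyc_prev N) {1..N} {1..N}"
  by (rule bij_betw_byWitness[where f' = "cyc_next N"])
     (auto simp: cyc_next_def cyc_prev_def)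

text \<open>
  Summation by parts against the constant function 1: the two cyclic shifts permute the grid, so
  each shifted sum equals the unshifted one, and the weights \<open>2, -1, -1\<close> cancel.
\<close>

lemma sum_fd_lap_eq_0: "(\<Sum>j=1..N. fd_lap N dx \<phi> j) = 0"
proof -
  have "(\<Sum>j=1..N. \<phi> (cyc_next N j)) = (\<Sum>j=1..N. \<phi> j)"
    by (rule sum.reindex_bij_betw[OF bij_betw_cyc_next])
  moreover have "(\<Sum>j=1..N. \<phi> (cyc_prev N j)) = (\<Sum>j=1..N. \<phi> j)"
    by (rule sum.reindex_bij_betw[OF bij_betw_cyc_prev])
  ultimately show ?thesis
    unfolding fd_lap_def sum_divide_distrib[symmetric]
    by (simp add: sum_subtractf sum_distrib_left[symmetric])
qed

lemma poisson_boltzmann_imp_discrete_neutrality: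
  assumes "poisson_boltzmann N dx \<xi> Z w S n\<^sub>0 \<phi>\<^sub>0 T\<^sub>e X \<phi>"
  shows "discrete_neutrality N dx \<xi> Z w S n\<^sub>0 \<phi>\<^sub>0 T\<^sub>e X \<phi>"
proof -
  let ?\<rho> = "\<lambda>j. \<Sum>k\<in>UNIV. w $ k * S (\<xi> j - X $ k)"
  let ?n = "\<lambda>j. n\<^sub>0 (\<xi> j) * exp ((\<phi> j - \<phi>\<^sub>0 (\<xi> j)) / T\<^sub>e (\<xi> j))"
  have "(\<Sum>j=1..N. Z * ?\<rho> j) = (\<Sum>j=1..N. fd_lap N dx \<phi> j + ?n j)"
    using assms by (intro sum.cong) (auto simp: poisson_boltzmann_def algebra_simps)
  also have "\<dots> = (\<Sum>j=1..N. ?n j)"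
    by (simp add: sum.distrib sum_fd_lap_eq_0[simplified])
  finally have "(\<Sum>j=1..N. Z * ?\<rho> j) * dx = (\<Sum>j=1..N. ?n j) * dx"
    by simp
  then show ?thesis
    unfolding discrete_neutrality_def
    by (simp only: sum_distrib_left sum_distrib_right mult.assoc)
qed

theorem theorem3p2:
  fixes N :: nat and L dx Z :: real and \<xi> :: "nat \<Rightarrow> real"
    and w :: "real ^ 'p" and S S' n\<^sub>0 \<phi>\<^sub>0 T\<^sub>e :: "real \<Rightarrow> real"
    and \<Phi> :: "real ^ 'p \<Rightarrow> nat \<Rightarrow> real" and I :: "real set"
  assumes N: "N \<ge> 3"
    and L: "L > 0"
    and dx: "dx = L / real N"
    and grid: "\<And>j. j \<in> {1..<N} \<Longrightarrow> \<xi> (j + 1) = \<xi> j + dx"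
    and Z: "Z > 0"
    and w: "\<And>k. w $ k > 0"
    and S_periodic: "\<And>x. S (x + L) = S x"
    and S_deriv: "\<And>x. (S has_real_derivative S' x) (at x)"
    and S'_cont: "continuous_on UNIV S'"
    and n0: "\<And>j. j \<in> {1..N} \<Longrightarrow> n\<^sub>0 (\<xi> j) > 0"
    and Te: "\<And>j. j \<in> {1..N} \<Longrightarrow> T\<^sub>e (\<xi> j) > 0"
    and potential_solves: "\<And>X. poisson_boltzmann N dx \<xi> Z w S n\<^sub>0 \<phi>\<^sub>0 T\<^sub>e X (\<Phi> X)"
    and potential_unique: "\<And>X \<psi> j. poisson_boltzmann N dx \<xi> Z w S n\<^sub>0 \<phi>\<^sub>0 T\<^sub>e X \<psi> \<Longrightarrow>
           j \<in> {1..N} \<Longrightarrow> \<psi> j = \<Phi> X j"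
    and potential_differentiable:
      "\<And>X j. j \<in> {1..N} \<Longrightarrow> (\<lambda>Y. \<Phi> Y j) differentiable (at X)"
    and I: "open I" "is_interval I"
  shows "(\<forall>X \<phi>. solves_A N dx \<xi> Z w S S' n\<^sub>0 \<phi>\<^sub>0 T\<^sub>e I X \<phi> \<longrightarrow>
            (\<forall>t\<in>I. discrete_neutrality N dx \<xi> Z w S n\<^sub>0 \<phi>\<^sub>0 T\<^sub>e (X t) (\<phi> t))) \<and>
         (\<forall>X V. solves_B w (hamiltonian N dx \<xi> Z w S n\<^sub>0 \<phi>\<^sub>0 T\<^sub>e \<Phi>) I X V \<longrightarrow>
            (\<forall>t\<in>I. discrete_neutrality N dx \<xi> Z w S n\<^sub>0 \<phi>\<^sub>0 T\<^sub>e (X t) (\<Phi> (X t))))"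
  using potential_solves
  by (auto simp: solves_A_def intro: poisson_boltzmann_imp_discrete_neutrality)

end
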